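(* If $G$ is a connected triangle-free graph with $n$ vertices and $m$ edges, then $$\chi(G) \leq \left\lceil \frac{m}{2\sqrt{n}} \right\rceil + 1.$$
   Context: All graphs are finite and simple (no loops, no multiple edges), with at least one vertex. $\chi(G)$ denotes the (vertex) chromatic number of $G$. A graph is triangle-free if it contains no $K_3$ as a subgraph. *)

theory Defs
  imports Complex_Main "Graph_Theory.Graph_Theory"
begin

text \<open>
  A finite simple graph is modelled by the locale \<^locale>\<open>graph\<close>: a finite, symmetric digraph
  without loops and without parallel arcs. Each undirected edge is thus represented by two
  opposite arcs, so the number of edges is \<open>card (uedges G)\<close>, not \<open>card (arcs G)\<close>.
\<close>

definition uedges :: "('a, 'b) pre_digraph \<Rightarrow> 'a set set" where
  "uedges G = {{u, v} | u v. u \<rightarrow>\<^bsub>G\<^esub> v}"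

definition triangle_free :: "('a, 'b) pre_digraph \<Rightarrow> bool" where
  "triangle_free G \<longleftrightarrow> \<not> (\<exists>H. subgraph H G \<and> K\<^bsub>3\<^esub> H)"

definition proper_coloring :: "('a, 'b) pre_digraph \<Rightarrow> nat \<Rightarrow> ('a \<Rightarrow> nat) \<Rightarrow> bool" where
  "proper_coloring G k c \<longleftrightarrow>
     (\<forall>v \<in> verts G. c v < k) \<and> (\<forall>u v. u \<rightarrow>\<^bsub>G\<^esub> v \<longrightarrow> c u \<noteq> c v)"

text \<open>The minimum below exists for every finite loopfree \<open>G\<close>, as the vertices can be numbered.\<close>

definition chromatic_number :: "('a, 'b) pre_digraph \<Rightarrow> nat" where
  "chromatic_number G = (LEAST k. \<exists>c. proper_coloring G k c)"

end

theory Submission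
  imports Defs
begin

text \<open>
  Let \<open>k = \<chi>(G) - 1\<close>; the claim says that \<open>m > 2 (k - 1) \<surd>n\<close>. Two estimates carry the proof.

  \<^item> Many edges. \<open>G\<close> is not \<open>k\<close>-colourable, so some set \<open>T\<close> of \<open>s\<close> vertices is not
    \<open>k\<close>-colourable either and induces a subgraph of minimum degree at least \<open>k\<close>
    (\<open>uncolorable_core\<close>). This subgraph has at least \<open>k s / 2\<close> edges, and as \<open>G\<close> is connected,
    each of the remaining \<open>n - s\<close> vertices contributes at least one more edge
    (\<open>connected_arc_count\<close>). Hence \<open>2 m \<ge> k s + 2 (n - s) = 2 n + (k - 2) s\<close>.

  \<^item> Many vertices. Since there are no triangles, the neighbourhood of a vertex can be given one
    colour. Removing a vertex of \<open>T\<close> and its at least \<open>k\<close> neighbours therefore lowers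
    the number of required colours by at most one, and induction on \<open>k\<close> gives
    \<open>s \<ge> (k + 1) (k + 2) / 2 - 1\<close> (\<open>triangle_free_uncolorable_card\<close>).

  By \<open>(\<surd>n - (k - 1))\<^sup>2 \<ge> 0\<close> we have \<open>n + (k - 1)\<^sup>2 \<ge> 2 (k - 1) \<surd>n\<close>, so it suffices that
  \<open>(k - 2) s > 2 (k - 1)\<^sup>2\<close>. The lower bound on \<open>s\<close> gives this for \<open>k \<ge> 3\<close>. For \<open>k = 2\<close> one
  has \<open>m \<ge> n > 2 \<surd>n\<close>, because \<open>n \<ge> s \<ge> 5\<close>; for \<open>k = 1\<close> only \<open>m > 0\<close> is needed,
  and for \<open>k = 0\<close> the claim is trivial.
\<close>

section \<open>Colourings of induced subgraphs\<close>

text \<open>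
  Here a graph is a symmetric irreflexive relation \<open>R\<close>, and a set \<open>S\<close> stands for the subgraph
  that it induces. This lets vertices be deleted without constructing new digraphs.
\<close>

definition colorable_on :: "('a \<times> 'a) set \<Rightarrow> 'a set \<Rightarrow> nat \<Rightarrow> bool" where
  "colorable_on R S k \<longleftrightarrow>
     (\<exists>c :: 'a \<Rightarrow> nat. (\<forall>v\<in>S. c v < k) \<and> (\<forall>u\<in>S. \<forall>v\<in>S. (u, v) \<in> R \<longrightarrow> c u \<noteq> c v))"

lemma colorable_on_empty [simp]: "colorable_on R {} k"
  by (simp add: colorable_on_def)

text \<open>A vertex with fewer than \<open>k\<close> neighbours always finds a free colour among \<open>k\<close>.\<close>

lemma colorable_on_add_low_degree:
  assumes "finite S" "sym R" "irrefl R"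
    and col: "colorable_on R (S - {v}) k"
    and deg: "card (R `` {v} \<inter> S) < k"
  shows "colorable_on R S k"
proof -
  obtain c where c: "\<forall>u\<in>S - {v}. c u < k"
      "\<forall>u\<in>S - {v}. \<forall>w\<in>S - {v}. (u, w) \<in> R \<longrightarrow> c u \<noteq> c w"
    using col by (auto simp: colorable_on_def)
  have "card (c ` (R `` {v} \<inter> S)) < card {..<k}"
    using card_image_le[of "R `` {v} \<inter> S" c] \<open>finite S\<close> deg by simp
  then have "\<not> {..<k} \<subseteq> c ` (R `` {v} \<inter> S)"
    using card_mono[of "c ` (R `` {v} \<inter> S)" "{..<k}"] \<open>finite S\<close> by auto
  then obtain a where a: "a < k" "a \<notin> c ` (R `` {v} \<inter> S)" by auto
  have vv: "(v, v) \<notin> R"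
    using \<open>irrefl R\<close> by (auto simp: irrefl_def)
  have "(c(v := a)) u \<noteq> (c(v := a)) w" if "u \<in> S" "w \<in> S" "(u, w) \<in> R" for u w
  proof -
    have "(w, u) \<in> R" using \<open>sym R\<close> that(3) by (rule symD)
    then have "u = v \<Longrightarrow> c w \<noteq> a" "w = v \<Longrightarrow> c u \<noteq> a" using that a(2) by auto
    then show ?thesis using that c(2) vv by auto
  qed
  moreover have "\<forall>u\<in>S. (c(v := a)) u < k"
    using c(1) a(1) by auto
  ultimately show ?thesis
    unfolding colorable_on_def by blast
qed

text \<open>Vertices of degree below \<open>k\<close> can be discarded one after another, since each of them
  leaves a graph that is still not \<open>k\<close>-colourable.\<close>

lemma uncolorable_core:
  assumes "finite S" "sym R" "irrefl R" "\<not> colorable_on R S k"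
  obtains T where "T \<subseteq> S" "\<not> colorable_on R T k" "\<forall>v\<in>T. k \<le> card (R `` {v} \<inter> T)"
proof -
  have "\<exists>T\<subseteq>S. \<not> colorable_on R T k \<and> (\<forall>v\<in>T. k \<le> card (R `` {v} \<inter> T))"
    using \<open>finite S\<close> \<open>\<not> colorable_on R S k\<close>
  proof (induction S rule: finite_psubset_induct)
    case (psubset S)
    show ?case
    proof (cases "\<forall>v\<in>S. k \<le> card (R `` {v} \<inter> S)")
      case True
      then show ?thesis using psubset.prems by blast
    next
      case False
      then obtain v where v: "v \<in> S" "card (R `` {v} \<inter> S) < k" by force
      have "\<not> colorable_on R (S - {v}) k"
        using colorable_on_add_low_degree[OF psubset.hyps assms(2,3) _ v(2)] psubset.prems by blast
      then obtain T where "T \<subseteq> S - {v}" "\<not> colorable_on R T k"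
          "\<forall>u\<in>T. k \<le> card (R `` {u} \<inter> T)"
        using psubset.IH[of "S - {v}"] v(1) by blast
      then show ?thesis by blast
    qed
  qed
  then show ?thesis using that by blast
qed

section \<open>Triangle-free graphs need many vertices\<close>

text \<open>Without triangles the neighbourhood of \<open>v\<close> is independent, so it can share one new
  colour; \<open>v\<close> then sees only that colour and takes an old one.\<close>

lemma colorable_on_add_closed_neighbourhood:
  assumes "sym R" "irrefl R"
    and tri: "\<And>x y z. (x, y) \<in> R \<Longrightarrow> (y, z) \<in> R \<Longrightarrow> (x, z) \<notin> R"
    and "0 < k"
    and col: "colorable_on R (S - insert v (R `` {v})) k"
  shows "colorable_on R S (Suc k)"
proof -
  obtain c where c: "\<forall>u\<in>S - insert v (R `` {v}). c u < k"
      "\<forall>u\<in>S - insert v (R `` {v}). \<forall>w\<in>S - insert v (R `` {v}). (u, w) \<in> R \<longrightarrow> c u \<noteq> c w"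
    using col by (auto simp: colorable_on_def)
  define d where "d u = (if (v, u) \<in> R then k else if u = v then 0 else c u)" for u
  have v: "(v, v) \<notin> R" using \<open>irrefl R\<close> by (auto simp: irrefl_def)
  have s: "(u, w) \<in> R \<Longrightarrow> (w, u) \<in> R" for u w
    using \<open>sym R\<close> by (auto dest: symD)
  have "\<forall>u\<in>S. d u < Suc k"
    using c(1) by (auto simp: d_def intro: less_SucI)
  moreover have "d u \<noteq> d w" if "u \<in> S" "w \<in> S" "(u, w) \<in> R" for u w
  proof (cases "(v, u) \<in> R")
    case True
    then have "(v, w) \<notin> R" using tri that(3) by blast
    moreover from this have "w \<noteq> v \<Longrightarrow> c w < k" using c(1) that(2) by auto
    ultimately show ?thesis using True \<open>0 < k\<close> by (auto simp: d_def)
  next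
    case nu: False
    then have wv: "w \<noteq> v" using s that(3) by blast
    show ?thesis
    proof (cases "(v, w) \<in> R")
      case True
      have "u \<noteq> v \<Longrightarrow> c u < k" using c(1) that(1) nu by auto
      then show ?thesis using True nu \<open>0 < k\<close> by (auto simp: d_def)
    next
      case False
      then have "u \<noteq> v" using that(3) by blast
      then show ?thesis using False nu wv c(2) that by (auto simp: d_def)
    qed
  qed
  ultimately show ?thesis
    unfolding colorable_on_def by blast
qed

lemma triangle_free_uncolorable_card:
  assumes "finite S" "sym R" "irrefl R"
    and tri: "\<And>x y z. (x, y) \<in> R \<Longrightarrow> (y, z) \<in> R \<Longrightarrow> (x, z) \<notin> R"
    and "1 \<le> k" and "\<not> colorable_on R S k"
  shows "(k + 1) * (k + 2) \<le> 2 * card S + 2"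
  using \<open>1 \<le> k\<close> \<open>finite S\<close> \<open>\<not> colorable_on R S k\<close>
proof (induction k arbitrary: S rule: dec_induct)
  case base
  \<comment> \<open>The constant colouring is not proper, so there is an edge.\<close>
  have "\<exists>u\<in>S. \<exists>v\<in>S. (u, v) \<in> R"
  proof (rule ccontr)
    assume "\<not> ?thesis"
    then have "colorable_on R S 1"
      unfolding colorable_on_def by (intro exI[of _ "\<lambda>_. 0"]) auto
    then show False using base(2) by blast
  qed
  then obtain u v where "u \<in> S" "v \<in> S" "(u, v) \<in> R" by blast
  moreover from this have "u \<noteq> v" using \<open>irrefl R\<close> by (auto simp: irrefl_def)
  ultimately have "2 \<le> card S"
    using base(1) card_mono[of S "{u, v}"] by simp
  then show ?case by simp
next
  case (step k)
  obtain T where T: "T \<subseteq> S" "\<not> colorable_on R T (Suc k)"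
      "\<forall>v\<in>T. Suc k \<le> card (R `` {v} \<inter> T)"
    by (rule uncolorable_core[OF step.prems(1) assms(2,3) step.prems(2)])
  have "finite T" using T(1) step.prems(1) finite_subset by blast
  have "T \<noteq> {}" using T(2) by auto
  then obtain v where v: "v \<in> T" by blast
  let ?N = "R `` {v} \<inter> T"
  let ?U = "T - insert v (R `` {v})"
  have "\<not> colorable_on R ?U k"
    using colorable_on_add_closed_neighbourhood[OF assms(2,3) tri] step.hyps(1) T(2) by auto
  then have IH: "(k + 1) * (k + 2) \<le> 2 * card ?U + 2"
    using step.IH \<open>finite T\<close> by blast
  have "T = ?U \<union> insert v ?N" using v by auto
  then have "card T = card (?U \<union> insert v ?N)" by (rule arg_cong)
  also have "\<dots> = card ?U + card (insert v ?N)"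
    using \<open>finite T\<close> by (intro card_Un_disjoint) auto
  also have "card (insert v ?N) = Suc (card ?N)"
    using \<open>finite T\<close> \<open>irrefl R\<close> by (intro card_insert_disjoint) (auto simp: irrefl_def)
  finally have "card T = card ?U + Suc (card ?N)" .
  then have "card ?U + (k + 2) \<le> card T" using T(3) v by auto
  also have "\<dots> \<le> card S" using T(1) step.prems(1) by (rule card_mono[rotated])
  finally show ?case using IH by (simp add: algebra_simps)
qed

section \<open>Counting arcs\<close>

lemma min_degree_arc_count:
  assumes "finite T" and deg: "\<forall>v\<in>T. k \<le> card (R `` {v} \<inter> T)"
  shows "k * card T \<le> card (R \<inter> T \<times> T)"
proof -
  have "R \<inter> T \<times> T = Sigma T (\<lambda>v. R `` {v} \<inter> T)" by auto
  then have "card (R \<inter> T \<times> T) = (\<Sum>v\<in>T. card (R `` {v} \<inter> T))"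
    using \<open>finite T\<close> by simp
  also have "\<dots> \<ge> (\<Sum>v\<in>T. k)" using deg by (intro sum_mono) auto
  finally show ?thesis by (simp add: mult.commute)
qed

text \<open>\<open>T\<close> grows to \<open>V\<close> one vertex at a time, each new vertex being attached by an
  edge to the part already reached. An edge counts as two arcs.\<close>

lemma connected_arc_count:
  assumes "finite V" "sym R"
    and conn: "\<And>T. T \<subseteq> V \<Longrightarrow> T \<noteq> {} \<Longrightarrow> T \<noteq> V \<Longrightarrow> \<exists>u\<in>T. \<exists>v\<in>V - T. (u, v) \<in> R"
    and "T \<subseteq> V" "T \<noteq> {}"
  shows "card (R \<inter> T \<times> T) + 2 * card (V - T) \<le> card (R \<inter> V \<times> V)"
  using \<open>T \<subseteq> V\<close> \<open>T \<noteq> {}\<close>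
proof (induction "card (V - T)" arbitrary: T)
  case 0
  then have "T = V" using \<open>finite V\<close> by auto
  then show ?case by simp
next
  case (Suc d)
  have "T \<noteq> V" using Suc.hyps(2) by auto
  then obtain u v where uv: "u \<in> T" "v \<in> V - T" "(u, v) \<in> R" "(v, u) \<in> R"
    using conn[OF Suc.prems] \<open>sym R\<close> by (meson symD)
  let ?T = "insert v T"
  have "finite T" using Suc.prems(1) \<open>finite V\<close> finite_subset by blast
  have "V - T = insert v (V - ?T)" using uv(2) by auto
  then have "card (V - T) = card (insert v (V - ?T))" by (rule arg_cong)
  also have "\<dots> = Suc (card (V - ?T))"
    using \<open>finite V\<close> by (intro card_insert_disjoint) auto
  finally have d: "card (V - T) = Suc (card (V - ?T))" .
  have "u \<noteq> v" using uv(1,2) by blast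
  then have "card {(u, v), (v, u)} = 2" by simp
  moreover have "(R \<inter> T \<times> T) \<inter> {(u, v), (v, u)} = {}" using uv(2) by auto
  moreover have "finite (R \<inter> T \<times> T)" using \<open>finite T\<close> by simp
  ultimately have "card (R \<inter> T \<times> T) + 2 = card ((R \<inter> T \<times> T) \<union> {(u, v), (v, u)})"
    by (simp only: card_Un_disjoint finite.intros)
  also have "\<dots> \<le> card (R \<inter> ?T \<times> ?T)"
  proof (rule card_mono)
    show "finite (R \<inter> ?T \<times> ?T)" using \<open>finite T\<close> by simp
    show "(R \<inter> T \<times> T) \<union> {(u, v), (v, u)} \<subseteq> R \<inter> ?T \<times> ?T" using uv by blast
  qed
  finally have "card (R \<inter> T \<times> T) + 2 \<le> card (R \<inter> ?T \<times> ?T)" .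
  moreover have "card (R \<inter> ?T \<times> ?T) + 2 * card (V - ?T) \<le> card (R \<inter> V \<times> V)"
    using Suc.hyps(1)[of ?T] Suc.hyps(2) Suc.prems uv(2) d by auto
  ultimately show ?case using d by simp
qed

section \<open>Translation from digraphs\<close>

lemma graph_irrefl_arcs_ends:
  assumes "graph G"
  shows "irrefl (arcs_ends G)"
proof -
  interpret graph G by fact
  show ?thesis
    using adj_not_same by (auto simp: irrefl_def)
qed

lemma not_colorable_on_below_chromatic_number:
  assumes "graph G" "k < chromatic_number G"
  shows "\<not> colorable_on (arcs_ends G) (verts G) k"
proof
  interpret graph G by fact
  assume "colorable_on (arcs_ends G) (verts G) k"
  then obtain c where c: "\<forall>v\<in>verts G. c v < k"
      "\<forall>u\<in>verts G. \<forall>v\<in>verts G. u \<rightarrow>\<^bsub>G\<^esub> v \<longrightarrow> c u \<noteq> c v"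
    unfolding colorable_on_def by blast
  have "proper_coloring G k c"
    unfolding proper_coloring_def using c by (auto dest: adj_in_verts)
  then show False
    using assms(2) not_less_Least[of k "\<lambda>k. \<exists>c. proper_coloring G k c"]
    unfolding chromatic_number_def by blast
qed

text \<open>Three pairwise adjacent vertices induce a copy of \<open>K\<^sub>3\<close>.\<close>

lemma triangle_free_arcs_ends:
  assumes "graph G" "triangle_free G" "x \<rightarrow>\<^bsub>G\<^esub> y" "y \<rightarrow>\<^bsub>G\<^esub> z"
  shows "\<not> x \<rightarrow>\<^bsub>G\<^esub> z"
proof
  interpret graph G by fact
  assume xz: "x \<rightarrow>\<^bsub>G\<^esub> z"
  let ?H = "G \<restriction> {x, y, z}"
  have ne: "x \<noteq> y" "y \<noteq> z" "x \<noteq> z" using assms(3,4) xz adj_not_same by auto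
  have vs: "{x, y, z} \<subseteq> verts G" using assms(3,4) xz adj_in_verts by auto
  have sub: "induced_subgraph ?H G" using vs by (rule induced_induce)
  have rev: "y \<rightarrow>\<^bsub>G\<^esub> x" "z \<rightarrow>\<^bsub>G\<^esub> y" "z \<rightarrow>\<^bsub>G\<^esub> x"
    using assms(3,4) xz graph_symmetric by blast+
  have dom: "u \<rightarrow>\<^bsub>?H\<^esub> w \<longleftrightarrow> u \<rightarrow>\<^bsub>G\<^esub> w \<and> u \<in> {x, y, z} \<and> w \<in> {x, y, z}" for u w
    by (auto simp: arcs_ends_conv)
  have "graph ?H"
    using digraphI_induced[OF sub] induced_graph_imp_graph[OF sub]
    by (simp add: graph_def pseudo_graph_def digraph_def)
  moreover have "arcs_ends ?H = {(u, v). (u, v) \<in> verts ?H \<times> verts ?H \<and> u \<noteq> v}"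
  proof -
    have adj: "u \<rightarrow>\<^bsub>G\<^esub> w" if "u \<in> {x, y, z}" "w \<in> {x, y, z}" "u \<noteq> w" for u w
      using that assms(3,4) xz rev by blast
    have "u \<rightarrow>\<^bsub>?H\<^esub> w \<longleftrightarrow> u \<in> {x, y, z} \<and> w \<in> {x, y, z} \<and> u \<noteq> w" for u w
      unfolding dom using adj adj_not_same by blast
    then show ?thesis
      unfolding induce_subgraph_verts
      by (intro set_eqI) (simp only: split_paired_all mem_Collect_eq case_prod_conv
          mem_Times_iff fst_conv snd_conv conj_assoc)
  qed
  moreover have "card (verts ?H) = 3" using ne by simp
  ultimately have "K\<^bsub>3\<^esub> ?H" by (simp add: complete_digraph_def)
  then show False
    using assms(2) induced_imp_subgraph[OF sub] unfolding triangle_free_def by blast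
qed

lemma connected_leaving_arc:
  assumes "graph G" "Digraph_Component.connected G"
    and "T \<subseteq> verts G" "T \<noteq> {}" "T \<noteq> verts G"
  shows "\<exists>u\<in>T. \<exists>v\<in>verts G - T. u \<rightarrow>\<^bsub>G\<^esub> v"
proof (rule ccontr)
  interpret graph G by fact
  assume no: "\<not> ?thesis"
  have sc: "strongly_connected G"
    using symmetric_connected_imp_strongly_connected sym_arcs assms(2) by blast
  obtain u v where uv: "u \<in> T" "v \<in> verts G" "v \<notin> T" using assms(3-5) by blast
  then have "u \<rightarrow>\<^sup>*\<^bsub>G\<^esub> v" using sc assms(3) by (auto simp: strongly_connected_def)
  then have "v \<in> T"
  proof (induction rule: reachable_induct)
    case base
    then show ?case using uv(1) by simp
  next
    case (step x y)
    then show ?case using no adj_in_verts by blast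
  qed
  then show False using uv(3) by simp
qed

lemma card_arcs_ends_le:
  assumes "graph G"
  shows "card (arcs_ends G) \<le> 2 * card (uedges G)"
proof -
  interpret graph G by fact
  have eq: "uedges G = (\<lambda>(u, v). {u, v}) ` arcs_ends G"
    by (auto simp: uedges_def)
  have fin: "finite (arcs_ends G)" by (simp add: arcs_ends_def)
  \<comment> \<open>Each edge has at most two orientations.\<close>
  have two: "card {p \<in> arcs_ends G. (\<lambda>(u, v). {u, v}) p = e} \<le> 2" if e: "e \<in> uedges G" for e
  proof -
    obtain u v where uv: "e = {u, v}" using e by (auto simp: uedges_def)
    have "{p \<in> arcs_ends G. (\<lambda>(u, v). {u, v}) p = e} \<subseteq> {(u, v), (v, u)}"
      unfolding uv case_prod_beta doubleton_eq_iff by (intro subsetI) (simp add: prod_eq_iff)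
    then have "card {p \<in> arcs_ends G. (\<lambda>(u, v). {u, v}) p = e} \<le> card {(u, v), (v, u)}"
      by (intro card_mono) auto
    also have "\<dots> \<le> 2" by (rule card_insert_le_m1) auto
    finally show ?thesis .
  qed
  have "arcs_ends G \<subseteq> (\<Union>e\<in>uedges G. {p \<in> arcs_ends G. (\<lambda>(u, v). {u, v}) p = e})"
    unfolding eq by blast
  then have "card (arcs_ends G) \<le>
      card (\<Union>e\<in>uedges G. {p \<in> arcs_ends G. (\<lambda>(u, v). {u, v}) p = e})"
    using fin eq by (intro card_mono) auto
  also have "\<dots> \<le> (\<Sum>e\<in>uedges G. card {p \<in> arcs_ends G. (\<lambda>(u, v). {u, v}) p = e})"
    using fin eq by (intro card_UN_le) auto
  also have "\<dots> \<le> (\<Sum>e\<in>uedges G. 2)" using two by (rule sum_mono)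
  finally show ?thesis by (simp add: mult.commute)
qed

section \<open>The edge bound\<close>

text \<open>The two counting estimates combined: here \<open>s\<close> is the order of an uncolourable core.\<close>

lemma edge_bound_arithmetic:
  fixes n m s k :: nat
  assumes "1 \<le> k" "s \<le> n"
    and s: "(k + 1) * (k + 2) \<le> 2 * s + 2"
    and m: "k * s + 2 * (n - s) \<le> 2 * m"
  shows "2 * (real k - 1) * sqrt (real n) < real m"
proof -
  define r where "r = sqrt (real n)"
  have r: "real n = r\<^sup>2" "0 \<le> r" by (simp_all add: r_def)
  have m': "2 * real n + (real k - 2) * real s \<le> 2 * real m"
  proof -
    have "real (k * s + 2 * (n - s)) \<le> real (2 * m)" using m by (rule of_nat_mono)
    then show ?thesis using \<open>s \<le> n\<close> by (simp add: of_nat_diff algebra_simps)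
  qed
  consider "k = 1" | "k = 2" | "3 \<le> k" using \<open>1 \<le> k\<close> by linarith
  then have "2 * (real k - 1) * r < real m"
  proof cases
    case 1
    then show ?thesis using s \<open>s \<le> n\<close> m by simp
  next
    case 2
    then have "5 \<le> real n" using s \<open>s \<le> n\<close> by simp
    then have "2\<^sup>2 < r\<^sup>2" using r(1) by simp
    then have "2 < r" using r(2) by (rule power2_less_imp_less)
    then have "2 * r < r * r" using r(2) by (intro mult_strict_right_mono) auto
    then show ?thesis using 2 m' r(1) by (simp add: power2_eq_square)
  next
    case 3
    have "4 * (k + 2) \<le> (k + 1) * (k + 2)" using 3 by (intro mult_right_mono) auto
    then have "4 * (k + 2) \<le> 2 * s + 2" using s by (rule order_trans)
    then have "2 * k + 3 \<le> s" by simp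
    then have "(real k - 2) * (2 * real k + 3) \<le> (real k - 2) * real s"
      using 3 by (intro mult_left_mono) auto
    moreover have "2 * (real k - 1)\<^sup>2 < (real k - 2) * (2 * real k + 3)"
      using 3 by (simp add: power2_eq_square algebra_simps)
    ultimately have "2 * (real k - 1)\<^sup>2 < (real k - 2) * real s" by linarith
    moreover have "0 \<le> (r - (real k - 1))\<^sup>2" by simp
    then have "2 * (real k - 1) * r \<le> real n + (real k - 1)\<^sup>2"
      unfolding r(1) by (simp add: power2_eq_square algebra_simps)
    ultimately show ?thesis using m' by linarith
  qed
  then show ?thesis by (simp add: r_def)
qed

theorem corollary7:
  fixes G :: "('a, 'b) pre_digraph" and n m :: nat
  assumes "graph G"
    and "Digraph_Component.connected G"
    and "triangle_free G"
    and "n = card (verts G)"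
    and "m = card (uedges G)"
  shows "int (chromatic_number G) \<le> \<lceil>real m / (2 * sqrt (real n))\<rceil> + 1"
proof (cases "chromatic_number G \<le> 1")
  case True
  have "0 \<le> real m / (2 * sqrt (real n))" by simp
  then have "0 \<le> \<lceil>real m / (2 * sqrt (real n))\<rceil>" by linarith
  then show ?thesis using True by linarith
next
  case False
  interpret graph G by fact
  define k where "k = chromatic_number G - 1"
  have k: "chromatic_number G = Suc k" "1 \<le> k" using False by (auto simp: k_def)
  let ?R = "arcs_ends G" and ?V = "verts G"
  have sym: "sym ?R" using sym_arcs by (simp add: symmetric_def)
  have irr: "irrefl ?R" using assms(1) by (rule graph_irrefl_arcs_ends)
  have "\<not> colorable_on ?R ?V k"
    using not_colorable_on_below_chromatic_number[OF assms(1)] k(1) by simp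
  then obtain T where T: "T \<subseteq> ?V" "\<not> colorable_on ?R T k"
      "\<forall>v\<in>T. k \<le> card (?R `` {v} \<inter> T)"
    by (rule uncolorable_core[OF finite_verts sym irr])
  have fin: "finite T" using T(1) finite_verts by (rule finite_subset)
  have ne: "T \<noteq> {}" using T(2) by auto
  have s: "(k + 1) * (k + 2) \<le> 2 * card T + 2"
    using triangle_free_uncolorable_card[OF fin sym irr _ k(2) T(2)]
      triangle_free_arcs_ends[OF assms(1,3)] by blast
  have "?R \<inter> ?V \<times> ?V = ?R" using adj_in_verts by auto
  then have "card (?R \<inter> T \<times> T) + 2 * card (?V - T) \<le> card ?R"
    using connected_arc_count[OF finite_verts sym connected_leaving_arc[OF assms(1,2)] T(1) ne]
    by simp
  moreover have "k * card T \<le> card (?R \<inter> T \<times> T)"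
    using fin T(3) by (rule min_degree_arc_count)
  moreover have "card ?R \<le> 2 * m"
    using card_arcs_ends_le[OF assms(1)] assms(5) by simp
  moreover have "card (?V - T) = n - card T"
    using card_Diff_subset[OF fin T(1)] assms(4) by simp
  ultimately have m: "k * card T + 2 * (n - card T) \<le> 2 * m" by simp
  have sn: "card T \<le> n" using card_mono[OF finite_verts T(1)] assms(4) by simp
  have "0 < card T" using fin ne by (simp add: card_gt_0_iff)
  then have "0 < 2 * sqrt (real n)" using sn by simp
  then have "real k - 1 < real m / (2 * sqrt (real n))"
    using edge_bound_arithmetic[OF k(2) sn s m] by (simp add: field_simps)
  then have "int k - 1 < \<lceil>real m / (2 * sqrt (real n))\<rceil>"
    by (simp add: less_ceiling_iff)
  then show ?thesis using k(1) by simp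
qed

end
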